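(* Let $W = (W_1, \ldots, W_d)$ be a random vector with values in $\mathbb{N}^d$ and $\mathbb{E}(W_i) = \lambda_i < \infty$ for $1 \le i \le d$. Let $Z = (Z_1, \ldots, Z_d)$ have independent coordinates with $Z_i \sim \mathrm{Poi}_{\lambda_i}$. Let $W' = (W'_1, \ldots, W'_d)$ be defined on the same probability space as $W$ with $(W, W')$ an exchangeable pair. Then for all $h : \mathbb{N}^d \to [0, 1]$ and any choice of constants $c_1,\ldots,c_d \in \mathbb{R}$, $$|\mathbb{E}h(W) - \mathbb{E}h(Z)| \leq \sum_{k=1}^d \alpha_k \Big[ \mathbb{E}\,\big|\lambda_k - c_k \mathbb{P}_W(A_k)\big| + \mathbb{E}\,\big|W_k - c_k \mathbb{P}_W(B_k)\big| \Big],$$ where $\alpha_k = \min(1, 1.4\,\lambda_k^{-1/2})$ and $$A_k = \{W'_k = W_k + 1,\ W'_j = W_j \text{ for } k+1 \leq j \leq d\},$$ $$B_k = \{W'_k = W_k - 1,\ W'_j = W_j \text{ for } k+1 \leq j \leq d\}.$$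
   Context: $\mathbb{N} = \{0,1,2,\ldots\}$. $\mathrm{Poi}_\lambda$ is the Poisson distribution with mean $\lambda$. The pair $(W,W')$ is exchangeable if $(W,W')$ and $(W',W)$ have the same distribution. $\mathbb{P}_W(\cdot)$ denotes conditional probability given $W$. If $\lambda_k = 0$ then $\alpha_k$ is read as $1$. *)

theory Defs
  imports "HOL-Probability.Probability"
begin

text \<open>
  \<^const>\<open>poisson_pmf\<close> is only characterised for a positive rate; the Poisson distribution with mean
  0 is the point mass at 0.
\<close>

definition Poi :: "real \<Rightarrow> nat pmf" where
  "Poi l = (if l = 0 then return_pmf 0 else poisson_pmf l)"

text \<open>
  $\mathbb{N}^d$ is represented by the functions on \<open>{1..d}\<close> that are undefined elsewhere. Its product
  sigma-algebra consists of all its subsets, so every function on it is measurable.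
\<close>

definition nat_vectors :: "nat \<Rightarrow> (nat \<Rightarrow> nat) measure" where
  "nat_vectors d = (\<Pi>\<^sub>M i\<in>{1..d}. count_space (UNIV :: nat set))"

text \<open>The random vector \<open>(X\<^sub>1, \<dots>, X\<^sub>d)\<close> formed from its coordinates.\<close>

definition random_vector :: "nat \<Rightarrow> (nat \<Rightarrow> 'a \<Rightarrow> nat) \<Rightarrow> 'a \<Rightarrow> (nat \<Rightarrow> nat)" where
  "random_vector d X \<omega> = (\<lambda>i\<in>{1..d}. X i \<omega>)"

definition exchangeable_pair :: "'a measure \<Rightarrow> 'b measure \<Rightarrow> ('a \<Rightarrow> 'b) \<Rightarrow> ('a \<Rightarrow> 'b) \<Rightarrow> bool" where
  "exchangeable_pair M S X X' \<longleftrightarrow>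
     distr M (S \<Otimes>\<^sub>M S) (\<lambda>\<omega>. (X \<omega>, X' \<omega>)) = distr M (S \<Otimes>\<^sub>M S) (\<lambda>\<omega>. (X' \<omega>, X \<omega>))"

text \<open>
  The conditional probability of the event \<open>A\<close> given the random element \<open>X\<close> with values in \<open>S\<close>:
  the conditional expectation of the indicator of \<open>A\<close> with respect to the sigma-algebra
  generated by \<open>X\<close>.
\<close>

definition cond_prob_given :: "'a measure \<Rightarrow> 'b measure \<Rightarrow> ('a \<Rightarrow> 'b) \<Rightarrow> 'a set \<Rightarrow> 'a \<Rightarrow> real" where
  "cond_prob_given M S X A = real_cond_exp M (vimage_algebra (space M) X S) (indicator A)"

text \<open>The case distinction is needed because \<open>0 powr a = 0\<close>.\<close>

definition poisson_alpha :: "real \<Rightarrow> real" where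
  "poisson_alpha l = (if l = 0 then 1 else min 1 (1.4 * l powr (-1/2)))"

text \<open>In the second event the difference is taken in the integers, without truncation at 0.\<close>

definition up_event :: "'a measure \<Rightarrow> nat \<Rightarrow> (nat \<Rightarrow> 'a \<Rightarrow> nat) \<Rightarrow> (nat \<Rightarrow> 'a \<Rightarrow> nat) \<Rightarrow> nat \<Rightarrow> 'a set" where
  "up_event M d X X' k =
     {\<omega> \<in> space M. X' k \<omega> = X k \<omega> + 1 \<and> (\<forall>j\<in>{k+1..d}. X' j \<omega> = X j \<omega>)}"

definition down_event :: "'a measure \<Rightarrow> nat \<Rightarrow> (nat \<Rightarrow> 'a \<Rightarrow> nat) \<Rightarrow> (nat \<Rightarrow> 'a \<Rightarrow> nat) \<Rightarrow> nat \<Rightarrow> 'a set" where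
  "down_event M d X X' k =
     {\<omega> \<in> space M. int (X' k \<omega>) = int (X k \<omega>) - 1 \<and> (\<forall>j\<in>{k+1..d}. X' j \<omega> = X j \<omega>)}"

end

theory Submission
  imports Defs
begin

text \<open>
  The coordinates of $W$ are replaced by independent Poisson variables one at a time. Let $u(x)$ be the
  average of $h$ over the first $k-1$ coordinates, so that $u$ depends on $x_k, \dots, x_d$ only. The
  bounded solution $g$ of the Stein equation $\lambda g(n+1) - n g(n) = f(n) - E f(Z_k)$ for
  $f(n) = u(x_1, \dots, n, \dots, x_d)$ depends on $x_{k+1}, \dots, x_d$, which do not change on $A_k$
  and $B_k$. Exchangeability therefore gives $E[g(W_k + 1) 1_{A_k}] = E[g(W_k) 1_{B_k}]$, and
  subtracting $c_k$ times this identity from the Stein equation bounds the error of the $k$-th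
  replacement by $\sup |g|$ times the bracket in the theorem.

  With $F$ the distribution function and $p$ the mass function of $Z_k$,
  $|g(j+1)| \le F(j)(1 - F(j)) / (\lambda p(j))$. The right-hand side is the reciprocal of
  $E[Z_k \mid Z_k > j] - E[Z_k \mid Z_k \le j]$, and both conditional means are estimated by bounds
  affine in $j$.
\<close>

subsection \<open>The Stein equation of the Poisson distribution\<close>

definition poisson_cdf :: "real \<Rightarrow> nat \<Rightarrow> real" where
  "poisson_cdf l j = (\<Sum>i\<le>j. pmf (poisson_pmf l) i)"

text \<open>Multiplied by the mass function at n, the Stein equation telescopes; summing it forward
  from n = 0 gives this quotient. The value at 0 is free, since the equation multiplies it by n = 0,
  and the choice 0 satisfies any bound.\<close>

definition stein_solution :: "real \<Rightarrow> (nat \<Rightarrow> real) \<Rightarrow> nat \<Rightarrow> real" where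
  "stein_solution l f n = (case n of 0 \<Rightarrow> 0 | Suc j \<Rightarrow>
     (\<Sum>i\<le>j. pmf (poisson_pmf l) i * (f i - measure_pmf.expectation (poisson_pmf l) f))
       / (l * pmf (poisson_pmf l) j))"

text \<open>Let S and R be the parts of E f over {..j} and {j<..}. Since E f = S + R, the centred
  sum equals (1 - F j) S - F j R. Both products lie between 0 and F j (1 - F j), which bounds their
  difference.\<close>

lemma abs_centred_sum_le:
  fixes p :: "nat pmf" and f :: "nat \<Rightarrow> real"
  assumes f: "\<And>i. f i \<in> {0..1}"
  defines "F \<equiv> \<lambda>j. \<Sum>i\<le>j. pmf p i"
  shows "\<bar>\<Sum>i\<le>j. pmf p i * (f i - measure_pmf.expectation p f)\<bar> \<le> F j * (1 - F j)"
proof -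
  have int: "integrable (measure_pmf p) g" if "\<And>i. g i \<in> {0..1::real}" for g
    using that by (intro measure_pmf.integrable_const_bound[where B = 1]) auto
  define S where "S = (\<Sum>i\<le>j. pmf p i * f i)"
  define R where "R = measure_pmf.expectation p (\<lambda>i. f i * indicator {j<..} i)"
  have head: "measure_pmf.expectation p (\<lambda>i. g i * indicator {..j} i) = (\<Sum>i\<le>j. pmf p i * g i)"
    for g :: "nat \<Rightarrow> real"
    by (subst integral_measure_pmf_real[where A = "{..j}"])
      (auto simp: mult.commute indicator_def split: if_splits intro!: sum.cong)
  have split: "measure_pmf.expectation p g =
      (\<Sum>i\<le>j. pmf p i * g i) + measure_pmf.expectation p (\<lambda>i. g i * indicator {j<..} i)"
    if "\<And>i. g i \<in> {0..1}" for g
  proof -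
    have "measure_pmf.expectation p g =
        measure_pmf.expectation p (\<lambda>i. g i * indicator {..j} i + g i * indicator {j<..} i)"
      by (intro Bochner_Integration.integral_cong) (auto simp: indicator_def)
    also have "\<dots> = measure_pmf.expectation p (\<lambda>i. g i * indicator {..j} i)
        + measure_pmf.expectation p (\<lambda>i. g i * indicator {j<..} i)"
      using that by (intro Bochner_Integration.integral_add int) (auto simp: indicator_def)
    finally show ?thesis by (simp add: head)
  qed
  have tail: "measure_pmf.expectation p (indicator {j<..}) = 1 - F j"
    using split[of "\<lambda>_. 1"] by (simp add: F_def)
  have R: "0 \<le> R" "R \<le> 1 - F j"
  proof -
    show "0 \<le> R" unfolding R_def using f by (intro Bochner_Integration.integral_nonneg) auto
    have "R \<le> measure_pmf.expectation p (indicator {j<..})"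
      unfolding R_def using f by (intro Bochner_Integration.integral_mono int) (auto simp: indicator_def)
    with tail show "R \<le> 1 - F j" by linarith
  qed
  have S: "0 \<le> S" "S \<le> F j"
    using f unfolding S_def F_def by (auto intro!: sum_nonneg sum_mono mult_left_le)
  have "(\<Sum>i\<le>j. pmf p i * (f i - measure_pmf.expectation p f)) = S - F j * (S + R)"
    using split[OF f] by (simp add: S_def R_def F_def right_diff_distrib sum_subtractf sum_distrib_right)
  also have "\<dots> = (1 - F j) * S - F j * R" by (simp add: algebra_simps)
  finally have eq: "(\<Sum>i\<le>j. pmf p i * (f i - measure_pmf.expectation p f)) = (1 - F j) * S - F j * R" .
  have "0 \<le> (1 - F j) * S" "(1 - F j) * S \<le> (1 - F j) * F j" "0 \<le> F j * R" "F j * R \<le> F j * (1 - F j)"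
    using R S by (auto intro!: mult_left_mono)
  then show ?thesis unfolding eq by (simp add: mult.commute abs_le_iff)
qed

section \<open>Bounds on F (1 - F) / (l p) for the Poisson distribution\<close>

context
  fixes l :: real
  assumes l: "0 < l"
begin

lemma poisson_pmf_rec: "l * pmf (poisson_pmf l) j = real (Suc j) * pmf (poisson_pmf l) (Suc j)"
  using l by (simp add: fact_Suc del: of_nat_Suc)

lemma poisson_pmf_pos: "0 < pmf (poisson_pmf l) j"
  using l by simp

lemma poisson_cdf_pos: "0 < poisson_cdf l j"
  unfolding poisson_cdf_def using poisson_pmf_pos by (intro sum_pos) auto

lemma poisson_cdf_Suc: "poisson_cdf l (Suc j) = poisson_cdf l j + pmf (poisson_pmf l) (Suc j)"
  by (simp add: poisson_cdf_def)

lemma poisson_cdf_le_1: "poisson_cdf l j \<le> 1"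
  using measure_pmf.prob_le_1[of "poisson_pmf l" "{..j}"]
  by (simp add: poisson_cdf_def measure_measure_pmf_finite)

lemma poisson_cdf_tendsto_1: "poisson_cdf l \<longlonglongrightarrow> 1"
proof -
  have "pmf (poisson_pmf l) = (\<lambda>k. (l ^ k /\<^sub>R fact k) * exp (- l))"
    using l by (simp add: fun_eq_iff field_simps)
  moreover have "(\<lambda>k. (l ^ k /\<^sub>R fact k) * exp (- l)) sums 1"
    using sums_mult2[OF exp_converges[of l], of "exp (- l)"] by (simp flip: exp_add)
  ultimately have "pmf (poisson_pmf l) sums 1" by simp
  then show ?thesis
    by (simp add: sums_def_le poisson_cdf_def[abs_def])
qed

text \<open>A subsolution \<open>a\<close> of the recursion \<open>a j = (j + 1) a (j + 1) / (a (j + 1) + l)\<close>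
  satisfied by \<open>l P(Z = j) / P(Z > j)\<close> makes the tail telescope.\<close>

lemma poisson_tail_le:
  assumes mono: "\<And>i. j \<le> i \<Longrightarrow> 0 < a i"
    and rec: "\<And>i. j \<le> i \<Longrightarrow> a i * (a (Suc i) + l) \<le> real (Suc i) * a (Suc i)"
  shows "(1 - poisson_cdf l j) * a j \<le> l * pmf (poisson_pmf l) j"
proof -
  \<comment> \<open>\<open>e i\<close> is the claimed bound on P(Z > i). The subsolution property
    says that each decrement of \<open>e\<close> pays for the mass at i + 1, so the mass in (j, n]
    is at most \<open>e j - e n\<close>.\<close>
  define e where "e i = l * pmf (poisson_pmf l) i / a i" for i
  have telescope: "pmf (poisson_pmf l) (Suc i) \<le> e i - e (Suc i)" if "j \<le> i" for i
  proof -
    have pos: "0 < a i" "0 < a (Suc i)" using mono that by auto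
    have "1 \<le> real (Suc i) / a i - l / a (Suc i)"
      using rec[OF that] pos by (simp add: field_simps)
    then have "pmf (poisson_pmf l) (Suc i) * 1
        \<le> pmf (poisson_pmf l) (Suc i) * (real (Suc i) / a i - l / a (Suc i))"
      by (intro mult_left_mono) auto
    also have "\<dots> = e i - e (Suc i)"
      unfolding e_def poisson_pmf_rec[of i] by (simp add: algebra_simps)
    finally show ?thesis by simp
  qed
  have "poisson_cdf l n - poisson_cdf l j \<le> e j - e n" if "j \<le> n" for n
    using that
  proof (induction n rule: dec_induct)
    case (step n)
    then show ?case using telescope[of n] by (simp add: poisson_cdf_Suc)
  qed simp
  moreover have "0 \<le> e n" if "j \<le> n" for n
    unfolding e_def using mono[OF that] l by (intro divide_nonneg_pos) auto
  \<comment> \<open>The sign of \<open>e n\<close> suffices to drop it, uniformly in n, before n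
    tends to infinity.\<close>
  ultimately have "\<forall>n\<ge>j. poisson_cdf l n \<le> poisson_cdf l j + e j" by fastforce
  then have "1 \<le> poisson_cdf l j + e j"
    by (intro LIMSEQ_le_const2[OF poisson_cdf_tendsto_1]) auto
  then show ?thesis
    unfolding e_def using mono[of j] by (simp add: field_simps)
qed

text \<open>The ratio r j = l P(Z = j) / P(Z \<le> j) equals l - E[Z | Z \<le> j]; it starts at r 0
  = l and satisfies r (j + 1) = l r j / (r j + j + 1). This expression increases with r j, so a
  positive subsolution \<open>b\<close> with \<open>b 0 \<le> l\<close> never exceeds r.\<close>

lemma poisson_head_le:
  assumes pos: "\<And>i. i \<le> j \<Longrightarrow> 0 < b i" and "b 0 \<le> l"
    and rec: "\<And>i. i < j \<Longrightarrow> b (Suc i) * (b i + real (Suc i)) \<le> l * b i"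
  shows "poisson_cdf l j * b j \<le> l * pmf (poisson_pmf l) j"
  using pos rec
proof (induction j)
  case 0
  then show ?case using \<open>b 0 \<le> l\<close> by (simp add: poisson_cdf_def mult.commute)
next
  case (Suc j)
  have b: "0 < b j" "0 < b (Suc j)" using Suc.prems by auto
  have "poisson_cdf l j * b j \<le> real (Suc j) * pmf (poisson_pmf l) (Suc j)"
    using Suc unfolding poisson_pmf_rec by auto
  then have "b j * (poisson_cdf l (Suc j) * b (Suc j))
      \<le> b (Suc j) * (b j + real (Suc j)) * pmf (poisson_pmf l) (Suc j)"
    using b unfolding poisson_cdf_Suc by (simp add: algebra_simps flip: of_nat_Suc)
  also have "\<dots> \<le> l * b j * pmf (poisson_pmf l) (Suc j)"
    using Suc.prems(2)[of j] by (intro mult_right_mono) auto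
  finally have "b j * (poisson_cdf l (Suc j) * b (Suc j)) \<le> b j * (l * pmf (poisson_pmf l) (Suc j))"
    by (simp add: mult_ac)
  then show ?case using b by simp
qed


text \<open>The affine bounds \<open>a\<close> and \<open>b\<close> have opposite slopes, so that \<open>j\<close> cancels when the tail and
  head estimates are added with weights \<open>P(Z \<le> j)\<close> and \<open>P(Z > j)\<close>.\<close>

lemma poisson_cdf_product_le:
  fixes \<gamma> \<beta> :: real
  defines "a \<equiv> \<lambda>i. \<gamma> + \<beta> * (real i + 1 - l)" and "b \<equiv> \<lambda>i. \<gamma> + \<beta> * (l - real i)"
  assumes \<beta>: "0 < \<beta>" and b0: "b 0 \<le> l"
    and a: "\<And>i. a i * (a (Suc i) + l) \<le> real (Suc i) * a (Suc i)"
    and b: "\<And>i. b (Suc i) * (b i + real (Suc i)) \<le> l * b i"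
  shows "poisson_cdf l j * (1 - poisson_cdf l j) * (2 * \<gamma> + \<beta>) \<le> l * pmf (poisson_pmf l) j"
proof -
  let ?F = "poisson_cdf l j" and ?q = "l * pmf (poisson_pmf l) j"
  have F: "0 \<le> ?F" "0 \<le> 1 - ?F" and q: "0 \<le> ?q"
    using poisson_cdf_pos[of j] poisson_cdf_le_1[of j] l by auto
  have tail: "(1 - ?F) * a j \<le> ?q"
  \<comment> \<open>Where the affine bound is nonpositive the estimate is trivial. Otherwise the
    slope \<beta> > 0 keeps \<open>a\<close> positive at all i \<ge> j, as the tail estimate
    requires; for the decreasing \<open>b\<close> the same argument works on i \<le> j.\<close>
  proof (cases "a j > 0")
    case True
    have "a j \<le> a i" if "j \<le> i" for i
      using that \<beta> by (simp add: a_def)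
    with True show ?thesis by (intro poisson_tail_le a) fastforce
  next
    case False
    then have "(1 - ?F) * a j \<le> 0" using F by (simp add: mult_nonneg_nonpos)
    with q show ?thesis by linarith
  qed
  have head: "?F * b j \<le> ?q"
  proof (cases "b j > 0")
    case True
    have "b j \<le> b i" if "i \<le> j" for i
      using that \<beta> by (simp add: b_def)
    with True show ?thesis by (intro poisson_head_le b b0) fastforce
  next
    case False
    then have "?F * b j \<le> 0" using F by (simp add: mult_nonneg_nonpos)
    with q show ?thesis by linarith
  qed
  have "?F * (1 - ?F) * (2 * \<gamma> + \<beta>) = ?F * ((1 - ?F) * a j) + (1 - ?F) * (?F * b j)"
    by (simp add: a_def b_def algebra_simps)
  also have "\<dots> \<le> ?F * ?q + (1 - ?F) * ?q"
    using F tail head by (intro add_mono mult_left_mono) auto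
  finally show ?thesis by (simp add: algebra_simps)
qed

text \<open>Two pairs of affine bounds give the two terms of the minimum: slope 1 with offset 0
  gives the constant 1, and slope 1/2 with an offset proportional to sqrt l gives 1.4 / sqrt l, the
  smaller term once sqrt l exceeds 1.4.\<close>

lemma poisson_cdf_product_le_alpha:
  "poisson_cdf l j * (1 - poisson_cdf l j) \<le> poisson_alpha l * (l * pmf (poisson_pmf l) j)"
proof -
  let ?G = "poisson_cdf l j * (1 - poisson_cdf l j)" and ?q = "l * pmf (poisson_pmf l) j"
  define s where "s = sqrt l"
  have s: "0 < s" "l = s\<^sup>2" using l by (auto simp: s_def)
  have "l powr (- 1 / 2) = inverse s"
    using powr_minus[of l "1 / 2"] l by (simp add: s_def powr_half_sqrt)
  then have alpha: "poisson_alpha l = min 1 (7 / 5 / s)"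
    using l by (simp add: poisson_alpha_def field_simps)
  \<comment> \<open>Here \<beta> = 1 and \<gamma> = 0: these are the trivial bounds E[Z | Z > j]
    \<ge> j + 1 and E[Z | Z \<le> j] \<le> j, whose gap is 2 \<gamma> + \<beta> = 1.\<close>
  have le1: "?G \<le> ?q"
    using poisson_cdf_product_le[of 1 0 j] l by (simp add: algebra_simps)
  show ?thesis
  proof (cases "s \<le> 7 / 5")
    case True
    then have "poisson_alpha l = 1" unfolding alpha using s by (simp add: field_simps)
    with le1 show ?thesis by simp
  next
    case False
    \<comment> \<open>The offset is chosen so that 2 g = s / 1.4; the extra 1/2 coming from the
      slope is given away at the end.\<close>
    define g where "g = 5 / 14 * s"
    have "7 / 5 * s \<le> s * s" using False s by (intro mult_right_mono) auto
    \<comment> \<open>The left side of \<open>key\<close> is (g + 1/4)^2. With slope 1/2, the right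
      side of each recursion exceeds the left by a perfect square plus l / 2 - (g + 1/4)^2, so
      \<open>key\<close> makes both valid at every i. \<open>g_le\<close> is the initial condition
      \<open>b 0 \<le> l\<close>.\<close>
    then have key: "g\<^sup>2 + g / 2 + 1 / 16 \<le> l / 2" and g_le: "g \<le> l / 2"
      using False unfolding g_def s(2) power2_eq_square by linarith+
    have "?G * (2 * g + 1 / 2) \<le> ?q"
    proof (rule poisson_cdf_product_le)
      show "g + 1 / 2 * (l - real 0) \<le> l" using g_le by simp
    next
      fix i
      define x where "x = real i + 1 - l"
      have "(g + 1 / 2 * x) * (g + 1 / 2 * (x + 1) + l) + (l / 2 - (g\<^sup>2 + g / 2 + 1 / 16))
          + (x / 2 + 1 / 4)\<^sup>2 = (x + l) * (g + 1 / 2 * (x + 1))"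
        by (simp add: power2_eq_square field_simps)
      then have "(g + 1 / 2 * x) * (g + 1 / 2 * (x + 1) + l) \<le> (x + l) * (g + 1 / 2 * (x + 1))"
        using key zero_le_power2[of "x / 2 + 1 / 4"] by linarith
      then show "(g + 1 / 2 * (real i + 1 - l)) * (g + 1 / 2 * (real (Suc i) + 1 - l) + l)
          \<le> real (Suc i) * (g + 1 / 2 * (real (Suc i) + 1 - l))"
        by (simp add: x_def algebra_simps)
    next
      fix i
      define y where "y = l - real (Suc i)"
      have "(g + 1 / 2 * y) * (g + 1 / 2 * (y + 1) + (l - y)) + (l / 2 - (g\<^sup>2 + g / 2 + 1 / 16))
          + (y / 2 - 1 / 4)\<^sup>2 = l * (g + 1 / 2 * (y + 1))"
        by (simp add: power2_eq_square field_simps)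
      then have "(g + 1 / 2 * y) * (g + 1 / 2 * (y + 1) + (l - y)) \<le> l * (g + 1 / 2 * (y + 1))"
        using key zero_le_power2[of "y / 2 - 1 / 4"] by linarith
      then show "(g + 1 / 2 * (l - real (Suc i))) * (g + 1 / 2 * (l - real i) + real (Suc i))
          \<le> l * (g + 1 / 2 * (l - real i))"
        by (simp add: y_def algebra_simps)
    qed simp
    moreover have "?G * (5 / 7 * s) \<le> ?G * (2 * g + 1 / 2)"
      using poisson_cdf_pos[of j] poisson_cdf_le_1[of j]
      by (intro mult_left_mono) (simp_all add: g_def)
    ultimately have "?G * (5 / 7 * s) \<le> ?q" by linarith
    then have "?G \<le> 7 / 5 / s * ?q" using s by (simp add: field_simps)
    moreover have "poisson_alpha l = 7 / 5 / s" unfolding alpha using False by (simp add: field_simps)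
    ultimately show ?thesis by simp
  qed
qed

section \<open>Size and recursion of the Stein solution\<close>

lemma abs_stein_solution_le:
  assumes "\<And>i. f i \<in> {0..1}"
  shows "\<bar>stein_solution l f n\<bar> \<le> poisson_alpha l"
proof (cases n)
  case 0
  then show ?thesis using l by (simp add: stein_solution_def poisson_alpha_def)
next
  case (Suc j)
  have q: "0 < l * pmf (poisson_pmf l) j" using l poisson_pmf_pos[of j] by (intro mult_pos_pos)
  have "\<bar>\<Sum>i\<le>j. pmf (poisson_pmf l) i * (f i - measure_pmf.expectation (poisson_pmf l) f)\<bar>
      \<le> poisson_alpha l * (l * pmf (poisson_pmf l) j)"
    using abs_centred_sum_le[of f, OF assms, where p = "poisson_pmf l" and j = j]
      poisson_cdf_product_le_alpha[of j]
    unfolding poisson_cdf_def by linarith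
  then show ?thesis
    unfolding stein_solution_def Suc nat.case abs_divide abs_of_pos[OF q]
    by (subst pos_divide_le_eq[OF q])
qed

text \<open>For n = j + 1 the identity l p(j) = n p(n) turns both terms into quotients by p(n),
  whose numerators are consecutive partial sums of the centred series; their difference is the
  single summand at n.\<close>

lemma stein_equation:
  "l * stein_solution l f (Suc n) - real n * stein_solution l f n
    = f n - measure_pmf.expectation (poisson_pmf l) f"
proof (cases n)
  case 0
  then show ?thesis using l by (simp add: stein_solution_def)
next
  case (Suc j)
  let ?p = "pmf (poisson_pmf l)" and ?e = "measure_pmf.expectation (poisson_pmf l) f"
  define t where "t = (\<Sum>i\<le>j. ?p i * (f i - ?e))"
  have "real n * stein_solution l f n = t / ?p n"
    unfolding Suc stein_solution_def nat.case poisson_pmf_rec[of j] t_def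
    by (simp del: pmf_poisson)
  moreover have "l * stein_solution l f (Suc n) = (t + ?p n * (f n - ?e)) / ?p n"
    using l unfolding Suc stein_solution_def t_def by (simp del: pmf_poisson)
  ultimately show ?thesis
    using poisson_pmf_pos[of n] by (simp add: add_divide_distrib del: pmf_poisson)
qed

end

subsection \<open>Resampling one coordinate\<close>

lemma poisson_alpha_nonneg: "0 \<le> poisson_alpha l"
  by (simp add: poisson_alpha_def)

section \<open>Measurability on the countable space of d-vectors\<close>

lemma space_nat_vectors: "space (nat_vectors d) = {1..d} \<rightarrow>\<^sub>E UNIV"
  by (simp add: nat_vectors_def space_PiM)

lemma countable_space_nat_vectors: "countable (space (nat_vectors d))"
  unfolding space_nat_vectors by (intro countable_PiE) auto

text \<open>Each singleton is a measurable box over the finite index set, and every subset of the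
  countable space is a countable union of singletons. This makes every real function of the random
  vectors measurable.\<close>

lemma sets_nat_vectors: "sets (nat_vectors d) = sets (count_space (space (nat_vectors d)))"
proof -
  have "{x} \<in> sets (nat_vectors d)" if "x \<in> space (nat_vectors d)" for x
  proof -
    have "{x} = (\<Pi>\<^sub>E i\<in>{1..d}. {x i})"
      using that by (subst PiE_singleton) (auto simp: space_nat_vectors PiE_def)
    also have "\<dots> \<in> sets (nat_vectors d)"
      unfolding nat_vectors_def by (rule sets_PiM_I_finite) auto
    finally show ?thesis .
  qed
  then have "A \<in> sets (nat_vectors d)" if "A \<subseteq> space (nat_vectors d)" for A
    using that countable_subset[OF that countable_space_nat_vectors]
    by (meson sets.countable subsetD)
  then have "sets (nat_vectors d) = Pow (space (nat_vectors d))"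
    using sets.sets_into_space by (intro equalityI subsetI PowI) (blast, blast)
  then show ?thesis by simp
qed

lemma sets_pair_nat_vectors:
  "sets (nat_vectors d \<Otimes>\<^sub>M nat_vectors d)
     = sets (count_space (space (nat_vectors d) \<times> space (nat_vectors d)))"
  using sets_pair_measure_cong[OF sets_nat_vectors[of d] sets_nat_vectors[of d]]
    pair_measure_countable[OF countable_space_nat_vectors[of d] countable_space_nat_vectors[of d]]
  by (simp only:)

lemma measurable_nat_vectors: "(f :: _ \<Rightarrow> real) \<in> borel_measurable (nat_vectors d)"
  by (subst measurable_cong_sets[OF sets_nat_vectors refl]) simp

lemma measurable_pair_nat_vectors:
  "(f :: _ \<Rightarrow> real) \<in> borel_measurable (nat_vectors d \<Otimes>\<^sub>M nat_vectors d)"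
  by (subst measurable_cong_sets[OF sets_pair_nat_vectors refl]) simp

lemma random_vector_measurable:
  assumes "\<And>i. i \<in> {1..d} \<Longrightarrow> X i \<in> measurable M (count_space UNIV)"
  shows "random_vector d X \<in> measurable M (nat_vectors d)"
  unfolding nat_vectors_def random_vector_def
  using assms by (rule measurable_restrict)

lemma random_vector_in_space: "random_vector d X \<omega> \<in> {1..d} \<rightarrow>\<^sub>E UNIV"
  by (simp add: random_vector_def)

lemma random_vector_nth: "i \<in> {1..d} \<Longrightarrow> random_vector d X \<omega> i = X i \<omega>"
  by (simp add: random_vector_def)

lemma fun_upd_nat_vectors:
  "x \<in> {1..d} \<rightarrow>\<^sub>E UNIV \<Longrightarrow> k \<in> {1..d} \<Longrightarrow> x(k := z) \<in> {1..d} \<rightarrow>\<^sub>E (UNIV :: nat set)"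
  by (auto simp: PiE_iff extensional_def)

section \<open>Averaging over single coordinates\<close>

definition resample :: "nat pmf \<Rightarrow> nat \<Rightarrow> ((nat \<Rightarrow> nat) \<Rightarrow> real) \<Rightarrow> (nat \<Rightarrow> nat) \<Rightarrow> real" where
  "resample p k u x = measure_pmf.expectation p (\<lambda>z. u (x(k := z)))"

lemma pmf_expectation_in_unit_interval:
  assumes "\<And>x. f x \<in> {0..1}"
  shows "measure_pmf.expectation p f \<in> {0..1::real}"
proof -
  have f: "0 \<le> f x" "f x \<le> 1" for x using assms[of x] by auto
  then have "integrable (measure_pmf p) f"
    by (intro measure_pmf.integrable_const_bound[where B = 1] AE_I2) auto
  then have "measure_pmf.expectation p f \<le> 1"
    using f by (intro measure_pmf.integral_le_const) auto
  moreover have "0 \<le> measure_pmf.expectation p f"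
    using f by (intro Bochner_Integration.integral_nonneg)
  ultimately show ?thesis by simp
qed

lemma resample_in_unit_interval:
  assumes "\<And>x. x \<in> {1..d} \<rightarrow>\<^sub>E UNIV \<Longrightarrow> u x \<in> {0..1}" "k \<in> {1..d}" "x \<in> {1..d} \<rightarrow>\<^sub>E UNIV"
  shows "resample p k u x \<in> {0..1}"
  unfolding resample_def
  by (rule pmf_expectation_in_unit_interval, rule assms(1), rule fun_upd_nat_vectors) (fact assms)+

text \<open>Averaged functions keep full d-vectors as arguments; this predicate records which
  coordinates still matter.\<close>

definition depends_on :: "nat \<Rightarrow> nat set \<Rightarrow> ((nat \<Rightarrow> nat) \<Rightarrow> real) \<Rightarrow> bool" where
  "depends_on d J u \<longleftrightarrow> (\<forall>x\<in>{1..d} \<rightarrow>\<^sub>E UNIV. \<forall>y\<in>{1..d} \<rightarrow>\<^sub>E UNIV. (\<forall>j\<in>J. x j = y j) \<longrightarrow> u x = u y)"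

lemma depends_on_fun_upd:
  assumes "depends_on d {k..d} u" "k \<in> {1..d}" "x \<in> {1..d} \<rightarrow>\<^sub>E UNIV" "y \<in> {1..d} \<rightarrow>\<^sub>E UNIV"
    "\<forall>j\<in>{k+1..d}. x j = y j"
  shows "u (x(k := z)) = u (y(k := z))"
proof -
  have "(x(k := z)) j = (y(k := z)) j" if "j \<in> {k..d}" for j
    using that assms(5) by (cases "j = k") auto
  then have "\<forall>j\<in>{k..d}. (x(k := z)) j = (y(k := z)) j" by (rule ballI)
  with assms(1) fun_upd_nat_vectors[OF assms(3,2)] fun_upd_nat_vectors[OF assms(4,2)]
  show ?thesis unfolding depends_on_def by simp
qed

lemma depends_on_resample:
  assumes "depends_on d {k..d} u" "k \<in> {1..d}"
  shows "depends_on d {k+1..d} (resample p k u)"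
  unfolding depends_on_def resample_def
proof (intro ballI impI)
  fix x y :: "nat \<Rightarrow> nat"
  assume "x \<in> {1..d} \<rightarrow>\<^sub>E UNIV" "y \<in> {1..d} \<rightarrow>\<^sub>E UNIV" "\<forall>j\<in>{k+1..d}. x j = y j"
  then have "(\<lambda>z. u (x(k := z))) = (\<lambda>z. u (y(k := z)))"
    by (intro ext depends_on_fun_upd[OF assms])
  then show "measure_pmf.expectation p (\<lambda>z. u (x(k := z))) = measure_pmf.expectation p (\<lambda>z. u (y(k := z)))"
    by simp
qed

text \<open>\<open>resample_upto lam k h\<close> is the expectation of \<open>h\<close> after the coordinates \<open>1, \<dots>, k\<close> have been
  replaced by independent Poisson variables.\<close>

primrec resample_upto :: "(nat \<Rightarrow> real) \<Rightarrow> nat \<Rightarrow> ((nat \<Rightarrow> nat) \<Rightarrow> real) \<Rightarrow> (nat \<Rightarrow> nat) \<Rightarrow> real" where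
  "resample_upto lam 0 h = h"
| "resample_upto lam (Suc k) h = resample (Poi (lam (Suc k))) (Suc k) (resample_upto lam k h)"

lemma resample_upto_in_unit_interval:
  assumes "\<And>x. x \<in> {1..d} \<rightarrow>\<^sub>E UNIV \<Longrightarrow> h x \<in> {0..1}" "k \<le> d" "x \<in> {1..d} \<rightarrow>\<^sub>E UNIV"
  shows "resample_upto lam k h x \<in> {0..1}"
  using assms(2,3)
proof (induction k arbitrary: x)
  case (Suc k)
  then show ?case unfolding resample_upto.simps
    by (intro resample_in_unit_interval[where d = d]) auto
qed (use assms in auto)

lemma depends_on_resample_upto:
  "k \<le> d \<Longrightarrow> depends_on d {k+1..d} (resample_upto lam k h)"
proof (induction k)
  case 0
  \<comment> \<open>Extensional functions also agree outside {1..d}, so agreement on {1..d} is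
    equality and any \<open>h\<close> qualifies.\<close>
  have "x = y" if "x \<in> {1..d} \<rightarrow>\<^sub>E UNIV" "y \<in> {1..d} \<rightarrow>\<^sub>E UNIV" "\<forall>j\<in>{1..d}. x j = y j"
    for x y :: "nat \<Rightarrow> nat"
    using that by (intro PiE_ext) auto
  then show ?case by (auto simp: depends_on_def)
next
  case (Suc k)
  then have "depends_on d {Suc k..d} (resample_upto lam k h)" by simp
  then show ?case using Suc.prems unfolding resample_upto.simps by (intro depends_on_resample) auto
qed

section \<open>Invariance of the law of Z under redrawing a coordinate\<close>

lemma integrable_unit_interval:
  fixes u :: "(nat \<Rightarrow> nat) \<Rightarrow> real"
  assumes "finite_measure P" "sets P = sets (nat_vectors d)"
    and "\<And>x. x \<in> {1..d} \<rightarrow>\<^sub>E UNIV \<Longrightarrow> u x \<in> {0..1}"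
  shows "integrable P u"
proof -
  interpret finite_measure P by fact
  have "space P = {1..d} \<rightarrow>\<^sub>E UNIV"
    using sets_eq_imp_space_eq[OF assms(2)] by (simp add: space_nat_vectors)
  with assms show ?thesis
    by (intro integrable_const_bound[where B = 1])
      (auto intro!: AE_I2 simp: measurable_nat_vectors measurable_cong_sets[OF assms(2) refl])
qed

text \<open>By Fubini, coordinate k can be averaged first and the others afterwards. Resampling is
  idempotent, so u and its resampled version have the same inner average.\<close>

lemma integral_PiM_resample:
  fixes p :: "nat \<Rightarrow> nat pmf"
  assumes u: "\<And>x. x \<in> {1..d} \<rightarrow>\<^sub>E UNIV \<Longrightarrow> u x \<in> {0..1}" and k: "k \<in> {1..d}"
  defines "P \<equiv> \<Pi>\<^sub>M i\<in>{1..d}. measure_pmf (p i)"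
  shows "(\<integral>x. resample (p k) k u x \<partial>P) = (\<integral>x. u x \<partial>P)"
proof -
  interpret product_prob_space "\<lambda>i. measure_pmf (p i)" "{1..d}" ..
  let ?I = "{1..d} - {k}"
  have sets_P: "sets P = sets (nat_vectors d)"
    unfolding P_def nat_vectors_def by (intro sets_PiM_cong) auto
  have P: "P = PiM (insert k ?I) (\<lambda>i. measure_pmf (p i))"
    using k by (simp add: P_def insert_absorb)
  have fin: "finite_measure P" unfolding P_def by unfold_locales
  have int: "integrable P v" if "\<And>x. x \<in> {1..d} \<rightarrow>\<^sub>E UNIV \<Longrightarrow> v x \<in> {0..1}" for v :: "_ \<Rightarrow> real"
    by (rule integrable_unit_interval[OF fin sets_P]) (rule that)
  have split: "(\<integral>x. v x \<partial>P) = (\<integral>x. resample (p k) k v x \<partial>PiM ?I (\<lambda>i. measure_pmf (p i)))"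
    if "\<And>x. x \<in> {1..d} \<rightarrow>\<^sub>E UNIV \<Longrightarrow> v x \<in> {0..1}" for v :: "_ \<Rightarrow> real"
  proof -
    have "integrable P v" by (rule int) (rule that)
    then show ?thesis
      unfolding P resample_def by (intro product_integral_insert) auto
  qed
  have "resample (p k) k (resample (p k) k u) = resample (p k) k u"
    by (simp add: resample_def[abs_def])
  moreover have "(\<integral>x. resample (p k) k u x \<partial>P)
      = (\<integral>x. resample (p k) k (resample (p k) k u) x \<partial>PiM ?I (\<lambda>i. measure_pmf (p i)))"
    by (rule split) (rule resample_in_unit_interval[OF u k])
  moreover have "(\<integral>x. u x \<partial>P) = (\<integral>x. resample (p k) k u x \<partial>PiM ?I (\<lambda>i. measure_pmf (p i)))"
    by (rule split) (rule u)
  ultimately show ?thesis by simp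
qed

text \<open>Independence says that the law of the vector is the product of its marginal laws, which
  reduces the claim to the product measure.\<close>

lemma integral_random_vector_resample:
  assumes "prob_space N" "prob_space.indep_vars N (\<lambda>_. count_space UNIV) Z {1..d}"
    and law: "\<And>i. i \<in> {1..d} \<Longrightarrow> distr N (count_space UNIV) (Z i) = measure_pmf (p i)"
    and u: "\<And>x. x \<in> {1..d} \<rightarrow>\<^sub>E UNIV \<Longrightarrow> u x \<in> {0..1}" and k: "k \<in> {1..d}"
  shows "(\<integral>\<omega>. resample (p k) k u (random_vector d Z \<omega>) \<partial>N) = (\<integral>\<omega>. u (random_vector d Z \<omega>) \<partial>N)"
proof -
  interpret prob_space N by fact
  have Z: "Z i \<in> measurable N (count_space UNIV)" if "i \<in> {1..d}" for i
    using assms(2) that by (auto simp: indep_vars_def)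
  have meas: "random_vector d Z \<in> measurable N (nat_vectors d)"
    using Z by (rule random_vector_measurable)
  have "indep_vars (\<lambda>_. count_space UNIV) Z {1..d} \<longleftrightarrow>
      distr N (\<Pi>\<^sub>M i\<in>{1..d}. count_space UNIV) (\<lambda>\<omega>. \<lambda>i\<in>{1..d}. Z i \<omega>)
        = (\<Pi>\<^sub>M i\<in>{1..d}. distr N (count_space UNIV) (Z i))"
    using k by (intro indep_vars_iff_distr_eq_PiM' Z) auto
  with assms(2) have "distr N (nat_vectors d) (random_vector d Z)
      = (\<Pi>\<^sub>M i\<in>{1..d}. distr N (count_space UNIV) (Z i))"
    by (simp only: nat_vectors_def random_vector_def[abs_def])
  also have "\<dots> = (\<Pi>\<^sub>M i\<in>{1..d}. measure_pmf (p i))"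
    using law by (intro PiM_cong) auto
  finally have P: "distr N (nat_vectors d) (random_vector d Z) = (\<Pi>\<^sub>M i\<in>{1..d}. measure_pmf (p i))" .
  show ?thesis
    using integral_PiM_resample[OF u k, where p = p]
    unfolding P[symmetric] integral_distr[OF meas measurable_nat_vectors] by simp
qed

subsection \<open>Exchangeable pairs\<close>

lemma exchangeable_pair_integral_swap:
  fixes G :: "(nat \<Rightarrow> nat) \<Rightarrow> (nat \<Rightarrow> nat) \<Rightarrow> real"
  assumes "X \<in> measurable M (nat_vectors d)" "X' \<in> measurable M (nat_vectors d)"
    and "exchangeable_pair M (nat_vectors d) X X'"
  shows "(\<integral>\<omega>. G (X \<omega>) (X' \<omega>) \<partial>M) = (\<integral>\<omega>. G (X' \<omega>) (X \<omega>) \<partial>M)"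
proof -
  let ?S = "nat_vectors d \<Otimes>\<^sub>M nat_vectors d"
  have "(\<lambda>\<omega>. (X \<omega>, X' \<omega>)) \<in> measurable M ?S" "(\<lambda>\<omega>. (X' \<omega>, X \<omega>)) \<in> measurable M ?S"
    using assms by (auto intro: measurable_Pair)
  then have "(\<integral>\<omega>. G (X \<omega>) (X' \<omega>) \<partial>M) = (\<integral>z. G (fst z) (snd z) \<partial>distr M ?S (\<lambda>\<omega>. (X \<omega>, X' \<omega>)))"
    "(\<integral>\<omega>. G (X' \<omega>) (X \<omega>) \<partial>M) = (\<integral>z. G (fst z) (snd z) \<partial>distr M ?S (\<lambda>\<omega>. (X' \<omega>, X \<omega>)))"
    by (simp_all add: integral_distr measurable_pair_nat_vectors)
  then show ?thesis using assms(3) by (simp add: exchangeable_pair_def)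
qed

lemma nat_vectors_pair_event_sets:
  assumes "X \<in> measurable M (nat_vectors d)" "X' \<in> measurable M (nat_vectors d)"
  shows "{\<omega> \<in> space M. Q (X \<omega>) (X' \<omega>)} \<in> sets M"
proof -
  let ?V = "space (nat_vectors d)"
  have "{z \<in> ?V \<times> ?V. Q (fst z) (snd z)} \<in> sets (nat_vectors d \<Otimes>\<^sub>M nat_vectors d)"
    by (auto simp: sets_pair_nat_vectors)
  from measurable_sets[OF measurable_Pair[OF assms] this]
  have "(\<lambda>\<omega>. (X \<omega>, X' \<omega>)) -` {z \<in> ?V \<times> ?V. Q (fst z) (snd z)} \<inter> space M \<in> sets M" .
  also have "(\<lambda>\<omega>. (X \<omega>, X' \<omega>)) -` {z \<in> ?V \<times> ?V. Q (fst z) (snd z)} \<inter> space M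
      = {\<omega> \<in> space M. Q (X \<omega>) (X' \<omega>)}"
    using assms[THEN measurable_space] by auto
  finally show ?thesis .
qed

text \<open>A single relation serves both events: W'_k = W_k - 1 in the integers means W_k = W'_k +
  1, so B_k is A_k with W and W' interchanged, the form on which exchangeability acts.\<close>

definition up_step :: "nat \<Rightarrow> nat \<Rightarrow> (nat \<Rightarrow> nat) \<Rightarrow> (nat \<Rightarrow> nat) \<Rightarrow> bool" where
  "up_step d k x x' \<longleftrightarrow> x' k = x k + 1 \<and> (\<forall>j\<in>{k+1..d}. x' j = x j)"

lemma up_event_eq:
  "k \<in> {1..d} \<Longrightarrow> up_event M d W W' k
    = {\<omega> \<in> space M. up_step d k (random_vector d W \<omega>) (random_vector d W' \<omega>)}"
  by (auto simp: up_event_def up_step_def random_vector_nth)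

lemma down_event_eq:
  "k \<in> {1..d} \<Longrightarrow> down_event M d W W' k
    = {\<omega> \<in> space M. up_step d k (random_vector d W' \<omega>) (random_vector d W \<omega>)}"
  by (auto simp: down_event_def up_step_def random_vector_nth)

text \<open>The weight v(X) is measurable for the sigma-algebra generated by X, so it may be
  multiplied into the defining property of conditional expectation; its bound provides
  integrability.\<close>

lemma (in prob_space) integral_cond_prob_given:
  fixes v :: "(nat \<Rightarrow> nat) \<Rightarrow> real"
  assumes X: "X \<in> measurable M (nat_vectors d)" and A: "A \<in> sets M"
    and v: "\<And>x. x \<in> {1..d} \<rightarrow>\<^sub>E UNIV \<Longrightarrow> \<bar>v x\<bar> \<le> b"
  shows "integrable M (cond_prob_given M (nat_vectors d) X A)"
    and "(\<integral>\<omega>. v (X \<omega>) * cond_prob_given M (nat_vectors d) X A \<omega> \<partial>M)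
      = (\<integral>\<omega>. v (X \<omega>) * indicator A \<omega> \<partial>M)"
proof -
  let ?F = "vimage_algebra (space M) X (nat_vectors d)"
  have X_space: "X \<in> space M \<rightarrow> space (nat_vectors d)"
    using measurable_space[OF X] by auto
  have "subalgebra M ?F"
    unfolding subalgebra_def using sets_image_in_sets[OF refl X] by simp
  then interpret finite_measure_subalgebra M ?F
    by unfold_locales
  have vF: "(\<lambda>\<omega>. v (X \<omega>)) \<in> borel_measurable ?F"
    by (rule measurable_compose[OF measurable_vimage_algebra1[OF X_space] measurable_nat_vectors])
  have ind: "indicator A \<in> borel_measurable M" using A by simp
  have "integrable M (indicator A :: _ \<Rightarrow> real)"
    using A by (intro integrable_const_bound[where B = 1]) auto
  then show "integrable M (cond_prob_given M (nat_vectors d) X A)"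
    unfolding cond_prob_given_def by (rule real_cond_exp_int)
  have "\<bar>v (X \<omega>) * indicator A \<omega>\<bar> \<le> b" if "\<omega> \<in> space M" for \<omega>
  proof -
    have "\<bar>v (X \<omega>)\<bar> \<le> b" using X_space that by (intro v) (auto simp: space_nat_vectors)
    then show ?thesis by (auto simp: indicator_def)
  qed
  then have "integrable M (\<lambda>\<omega>. v (X \<omega>) * indicator A \<omega>)"
    using A measurable_compose[OF X measurable_nat_vectors]
    by (intro integrable_const_bound[where B = b] AE_I2) auto
  then show "(\<integral>\<omega>. v (X \<omega>) * cond_prob_given M (nat_vectors d) X A \<omega> \<partial>M)
      = (\<integral>\<omega>. v (X \<omega>) * indicator A \<omega> \<partial>M)"
    unfolding cond_prob_given_def by (rule real_cond_exp_intg(2)[OF _ vF ind])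
qed

lemma
  fixes v f :: "'a \<Rightarrow> real"
  assumes f: "integrable M f" and v: "v \<in> borel_measurable M" "\<And>x. x \<in> space M \<Longrightarrow> \<bar>v x\<bar> \<le> b"
  shows integrable_bounded_mult: "integrable M (\<lambda>x. v x * f x)"
    and abs_integral_bounded_mult_le: "\<bar>\<integral>x. v x * f x \<partial>M\<bar> \<le> b * (\<integral>x. \<bar>f x\<bar> \<partial>M)"
proof -
  have le: "\<bar>v x * f x\<bar> \<le> b * \<bar>f x\<bar>" if "x \<in> space M" for x
    unfolding abs_mult using v(2)[OF that] by (intro mult_right_mono) auto
  have int: "integrable M (\<lambda>x. b * \<bar>f x\<bar>)" using f by simp
  then show vf: "integrable M (\<lambda>x. v x * f x)"
    using f v le by (rule_tac Bochner_Integration.integrable_bound[OF int])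
      (auto intro!: AE_I2 order_trans[OF le abs_ge_self])
  have "\<bar>\<integral>x. v x * f x \<partial>M\<bar> \<le> (\<integral>x. \<bar>v x * f x\<bar> \<partial>M)" by (rule integral_abs_bound)
  also have "\<dots> \<le> (\<integral>x. b * \<bar>f x\<bar> \<partial>M)"
    using vf int le by (intro Bochner_Integration.integral_mono) auto
  finally show "\<bar>\<integral>x. v x * f x \<partial>M\<bar> \<le> b * (\<integral>x. \<bar>f x\<bar> \<partial>M)" by simp
qed

section \<open>The error of replacing one coordinate\<close>

lemma resample_error_le:
  fixes W W' :: "nat \<Rightarrow> 'a \<Rightarrow> nat" and u :: "(nat \<Rightarrow> nat) \<Rightarrow> real"
  assumes M: "prob_space M"
    and W: "\<And>i. i \<in> {1..d} \<Longrightarrow> W i \<in> measurable M (count_space UNIV)"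
    and W': "\<And>i. i \<in> {1..d} \<Longrightarrow> W' i \<in> measurable M (count_space UNIV)"
    and exch: "exchangeable_pair M (nat_vectors d) (random_vector d W) (random_vector d W')"
    and k: "k \<in> {1..d}"
    and W_int: "integrable M (\<lambda>\<omega>. real (W k \<omega>))"
    and mean: "(\<integral>\<omega>. real (W k \<omega>) \<partial>M) = l"
    and u: "\<And>x. x \<in> {1..d} \<rightarrow>\<^sub>E UNIV \<Longrightarrow> u x \<in> {0..1}"
    and dep: "depends_on d {k..d} u"
  shows "\<bar>(\<integral>\<omega>. u (random_vector d W \<omega>) \<partial>M) - (\<integral>\<omega>. resample (Poi l) k u (random_vector d W \<omega>) \<partial>M)\<bar>
    \<le> poisson_alpha l *
        ((\<integral>\<omega>. \<bar>l - c * cond_prob_given M (nat_vectors d) (random_vector d W)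
                            (up_event M d W W' k) \<omega>\<bar> \<partial>M)
       + (\<integral>\<omega>. \<bar>real (W k \<omega>) - c * cond_prob_given M (nat_vectors d) (random_vector d W)
                            (down_event M d W W' k) \<omega>\<bar> \<partial>M))"
    (is "_ \<le> _ * (?a + ?b)")
proof -
  interpret prob_space M by fact
  define X where "X = random_vector d W"
  define X' where "X' = random_vector d W'"
  have X: "X \<in> measurable M (nat_vectors d)" and X': "X' \<in> measurable M (nat_vectors d)"
    unfolding X_def X'_def using W W' by (auto intro: random_vector_measurable)
  have X_in: "X \<omega> \<in> {1..d} \<rightarrow>\<^sub>E UNIV" and X'_in: "X' \<omega> \<in> {1..d} \<rightarrow>\<^sub>E UNIV" for \<omega>
    unfolding X_def X'_def by (rule random_vector_in_space)+
  have Xk: "X \<omega> k = W k \<omega>" for \<omega> unfolding X_def using k by (rule random_vector_nth)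
  have fX: "(\<lambda>\<omega>. f (X \<omega>)) \<in> borel_measurable M" for f :: "_ \<Rightarrow> real"
    by (rule measurable_compose[OF X measurable_nat_vectors])
  have "0 \<le> l" unfolding mean[symmetric] by (intro Bochner_Integration.integral_nonneg) simp
  then consider "l = 0" | "0 < l" by linarith
  then show ?thesis
  proof cases
    \<comment> \<open>Mean 0 forces W_k = 0 almost surely, and \<open>Poi 0\<close> is the point
      mass at 0, so resampling coordinate k changes nothing.\<close>
    case 1
    have "AE \<omega> in M. real (W k \<omega>) = 0"
      using integral_nonneg_eq_0_iff_AE[OF W_int] mean 1 by simp
    then have "AE \<omega> in M. u (X \<omega>) = resample (Poi l) k u (X \<omega>)"
      by eventually_elim (simp add: resample_def Poi_def 1 fun_upd_idem Xk)
    then have "(\<integral>\<omega>. u (X \<omega>) \<partial>M) = (\<integral>\<omega>. resample (Poi l) k u (X \<omega>) \<partial>M)"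
      by (intro integral_cong_AE fX)
    moreover have "0 \<le> poisson_alpha l * (?a + ?b)"
      by (intro mult_nonneg_nonneg add_nonneg_nonneg poisson_alpha_nonneg
          Bochner_Integration.integral_nonneg) simp_all
    ultimately show ?thesis unfolding X_def by simp
  next
    case 2
    define A where "A = up_event M d W W' k"
    define B where "B = down_event M d W W' k"
    have A_eq: "A = {\<omega> \<in> space M. up_step d k (X \<omega>) (X' \<omega>)}"
      and B_eq: "B = {\<omega> \<in> space M. up_step d k (X' \<omega>) (X \<omega>)}"
      unfolding A_def B_def X_def X'_def using k by (rule up_event_eq, rule down_event_eq)
    have AB: "A \<in> sets M" "B \<in> sets M"
      unfolding A_eq B_eq using nat_vectors_pair_event_sets[of _ M d _ "up_step d k"] X X' by blast+
    define PA where "PA = cond_prob_given M (nat_vectors d) X A"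
    define PB where "PB = cond_prob_given M (nat_vectors d) X B"
    \<comment> \<open>For each x, \<open>g x\<close> solves the Stein equation for the section of u
      through x along coordinate k; \<phi> and \<psi> evaluate it at x k + 1 and at x k.\<close>
    define g where "g x = stein_solution l (\<lambda>z. u (x(k := z)))" for x
    define \<phi> where "\<phi> x = g x (Suc (x k))" for x
    define \<psi> where "\<psi> x = g x (x k)" for x
    have g_le: "\<bar>g x n\<bar> \<le> poisson_alpha l" if "x \<in> {1..d} \<rightarrow>\<^sub>E UNIV" for x n
      unfolding g_def using u[OF fun_upd_nat_vectors[OF that k]] by (intro abs_stein_solution_le 2)
    have \<phi>_le: "\<bar>\<phi> x\<bar> \<le> poisson_alpha l" and \<psi>_le: "\<bar>\<psi> x\<bar> \<le> poisson_alpha l"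
      if "x \<in> {1..d} \<rightarrow>\<^sub>E UNIV" for x
      unfolding \<phi>_def \<psi>_def using g_le[OF that] by auto
    \<comment> \<open>\<open>g x\<close> overwrites coordinate k and ignores the earlier ones, so it
      is determined by the coordinates beyond k, which an up-step leaves fixed.\<close>
    have g_up_step: "g x' = g x"
      if "x \<in> {1..d} \<rightarrow>\<^sub>E UNIV" "x' \<in> {1..d} \<rightarrow>\<^sub>E UNIV" "up_step d k x x'" for x x'
    proof -
      have "u (x'(k := z)) = u (x(k := z))" for z
        using that by (intro depends_on_fun_upd[OF dep k]) (auto simp: up_step_def)
      then show ?thesis by (simp add: g_def)
    qed
    have PA_int: "integrable M PA" and PB_int: "integrable M PB"
      unfolding PA_def PB_def using integral_cond_prob_given(1)[OF X _ \<phi>_le] AB by auto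
    have "(\<integral>\<omega>. \<phi> (X \<omega>) * PA \<omega> \<partial>M) = (\<integral>\<omega>. \<phi> (X \<omega>) * indicator A \<omega> \<partial>M)"
      unfolding PA_def using AB(1) \<phi>_le by (rule integral_cond_prob_given(2)[OF X])
    also have "\<dots> = (\<integral>\<omega>. \<phi> (X \<omega>) * of_bool (up_step d k (X \<omega>) (X' \<omega>)) \<partial>M)"
      unfolding A_eq by (intro Bochner_Integration.integral_cong) (auto simp: indicator_def)
    also have "\<dots> = (\<integral>\<omega>. \<phi> (X' \<omega>) * of_bool (up_step d k (X' \<omega>) (X \<omega>)) \<partial>M)"
      using exch unfolding X_def[symmetric] X'_def[symmetric]
      by (rule exchangeable_pair_integral_swap[OF X X',
            where G = "\<lambda>x x'. \<phi> x * of_bool (up_step d k x x')"])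
    \<comment> \<open>After the swap the event is B. There X k = X' k + 1, so the solution attached
      to X', which is also the one attached to X, is evaluated at X k.\<close>
    also have "\<dots> = (\<integral>\<omega>. \<psi> (X \<omega>) * indicator B \<omega> \<partial>M)"
    proof (intro Bochner_Integration.integral_cong refl)
      fix \<omega> assume \<omega>: "\<omega> \<in> space M"
      show "\<phi> (X' \<omega>) * of_bool (up_step d k (X' \<omega>) (X \<omega>)) = \<psi> (X \<omega>) * indicator B \<omega>"
      proof (cases "up_step d k (X' \<omega>) (X \<omega>)")
        case True
        then have "\<phi> (X' \<omega>) = \<psi> (X \<omega>)"
          using g_up_step[OF X'_in X_in True] by (simp add: \<phi>_def \<psi>_def up_step_def)
        with True \<omega> show ?thesis by (simp add: B_eq)
      qed (simp add: B_eq)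
    qed
    also have "\<dots> = (\<integral>\<omega>. \<psi> (X \<omega>) * PB \<omega> \<partial>M)"
      unfolding PB_def using AB(2) \<psi>_le by (rule integral_cond_prob_given(2)[OF X, symmetric])
    finally have swap: "(\<integral>\<omega>. \<phi> (X \<omega>) * PA \<omega> \<partial>M) = (\<integral>\<omega>. \<psi> (X \<omega>) * PB \<omega> \<partial>M)" .
    have u_int: "integrable M (\<lambda>\<omega>. u (X \<omega>))" "integrable M (\<lambda>\<omega>. resample (Poi l) k u (X \<omega>))"
      using u[OF X_in] resample_in_unit_interval[OF u k X_in]
      by (auto intro!: integrable_const_bound[where B = 1] AE_I2 fX)
    have mult_int: "integrable M (\<lambda>\<omega>. v (X \<omega>) * f \<omega>)"
      if "integrable M f" "\<And>x. x \<in> {1..d} \<rightarrow>\<^sub>E UNIV \<Longrightarrow> \<bar>v x\<bar> \<le> poisson_alpha l"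
      for f and v :: "_ \<Rightarrow> real"
      by (rule integrable_bounded_mult[OF that(1) fX]) (rule that(2)[OF X_in])
    have int: "integrable M (\<lambda>\<omega>. \<phi> (X \<omega>) * l)" "integrable M (\<lambda>\<omega>. \<phi> (X \<omega>) * PA \<omega>)"
      "integrable M (\<lambda>\<omega>. \<psi> (X \<omega>) * real (W k \<omega>))" "integrable M (\<lambda>\<omega>. \<psi> (X \<omega>) * PB \<omega>)"
      by (rule mult_int, simp add: PA_int PB_int W_int, erule \<phi>_le \<psi>_le)+
    \<comment> \<open>This is the Stein equation at n = W_k: overwriting coordinate k of X by its
      own value gives back u(X).\<close>
    have "u (X \<omega>) - resample (Poi l) k u (X \<omega>) = \<phi> (X \<omega>) * l - \<psi> (X \<omega>) * real (W k \<omega>)" for \<omega>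
      using stein_equation[OF 2, of "\<lambda>z. u ((X \<omega>)(k := z))" "X \<omega> k"] 2
      by (simp add: resample_def Poi_def \<phi>_def \<psi>_def g_def Xk[symmetric] mult.commute)
    then have "(\<integral>\<omega>. u (X \<omega>) \<partial>M) - (\<integral>\<omega>. resample (Poi l) k u (X \<omega>) \<partial>M)
        = (\<integral>\<omega>. \<phi> (X \<omega>) * l - \<psi> (X \<omega>) * real (W k \<omega>) \<partial>M)"
      by (simp flip: Bochner_Integration.integral_diff[OF u_int])
    also have "\<dots> = (\<integral>\<omega>. \<phi> (X \<omega>) * l \<partial>M) - (\<integral>\<omega>. \<psi> (X \<omega>) * real (W k \<omega>) \<partial>M)"
      by (rule Bochner_Integration.integral_diff[OF int(1,3)])
    \<comment> \<open>The conditional probabilities enter here: c E[\<phi>(X) PA] and c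
      E[\<psi>(X) PB] are split off from the two terms and cancel by \<open>swap\<close>.\<close>
    also have "(\<integral>\<omega>. \<phi> (X \<omega>) * l \<partial>M)
        = (\<integral>\<omega>. \<phi> (X \<omega>) * (l - c * PA \<omega>) \<partial>M) + c * (\<integral>\<omega>. \<phi> (X \<omega>) * PA \<omega> \<partial>M)"
      using Bochner_Integration.integral_diff[OF int(1) integrable_mult_right[OF int(2), of c]]
      by (simp add: algebra_simps)
    also have "(\<integral>\<omega>. \<psi> (X \<omega>) * real (W k \<omega>) \<partial>M)
        = (\<integral>\<omega>. \<psi> (X \<omega>) * (real (W k \<omega>) - c * PB \<omega>) \<partial>M) + c * (\<integral>\<omega>. \<psi> (X \<omega>) * PB \<omega> \<partial>M)"
      using Bochner_Integration.integral_diff[OF int(3) integrable_mult_right[OF int(4), of c]]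
      by (simp add: algebra_simps)
    finally have eq: "(\<integral>\<omega>. u (X \<omega>) \<partial>M) - (\<integral>\<omega>. resample (Poi l) k u (X \<omega>) \<partial>M)
        = (\<integral>\<omega>. \<phi> (X \<omega>) * (l - c * PA \<omega>) \<partial>M) - (\<integral>\<omega>. \<psi> (X \<omega>) * (real (W k \<omega>) - c * PB \<omega>) \<partial>M)"
      by (simp add: swap)
    have "\<bar>\<integral>\<omega>. \<phi> (X \<omega>) * (l - c * PA \<omega>) \<partial>M\<bar> \<le> poisson_alpha l * (\<integral>\<omega>. \<bar>l - c * PA \<omega>\<bar> \<partial>M)"
      using PA_int by (intro abs_integral_bounded_mult_le fX[of \<phi>] \<phi>_le X_in) simp
    moreover have "\<bar>\<integral>\<omega>. \<psi> (X \<omega>) * (real (W k \<omega>) - c * PB \<omega>) \<partial>M\<bar>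
        \<le> poisson_alpha l * (\<integral>\<omega>. \<bar>real (W k \<omega>) - c * PB \<omega>\<bar> \<partial>M)"
      using PB_int W_int by (intro abs_integral_bounded_mult_le fX[of \<psi>] \<psi>_le X_in) simp
    ultimately show ?thesis
      using eq unfolding PA_def PB_def A_def B_def X_def distrib_left by linarith
  qed
qed

section \<open>Telescoping over the coordinates\<close>

theorem proposition10:
  fixes M :: "'a measure" and N :: "'b measure"
    and d :: nat
    and W W' :: "nat \<Rightarrow> 'a \<Rightarrow> nat"
    and Z :: "nat \<Rightarrow> 'b \<Rightarrow> nat"
    and lam c :: "nat \<Rightarrow> real"
    and h :: "(nat \<Rightarrow> nat) \<Rightarrow> real"
  assumes "prob_space M" and "prob_space N"
    and "\<And>i. i \<in> {1..d} \<Longrightarrow> W i \<in> measurable M (count_space UNIV)"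
    and "\<And>i. i \<in> {1..d} \<Longrightarrow> integrable M (\<lambda>\<omega>. real (W i \<omega>))"
    and "\<And>i. i \<in> {1..d} \<Longrightarrow> (\<integral>\<omega>. real (W i \<omega>) \<partial>M) = lam i"
    and "prob_space.indep_vars N (\<lambda>_. count_space UNIV) Z {1..d}"
    and "\<And>i. i \<in> {1..d} \<Longrightarrow> distr N (count_space UNIV) (Z i) = measure_pmf (Poi (lam i))"
    and "\<And>i. i \<in> {1..d} \<Longrightarrow> W' i \<in> measurable M (count_space UNIV)"
    and "exchangeable_pair M (nat_vectors d) (random_vector d W) (random_vector d W')"
    and "\<And>x. x \<in> {1..d} \<rightarrow>\<^sub>E UNIV \<Longrightarrow> h x \<in> {0..1}"
  shows "\<bar>(\<integral>\<omega>. h (random_vector d W \<omega>) \<partial>M) - (\<integral>\<omega>. h (random_vector d Z \<omega>) \<partial>N)\<bar>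
    \<le> (\<Sum>k=1..d. poisson_alpha (lam k) *
          ((\<integral>\<omega>. \<bar>lam k - c k * cond_prob_given M (nat_vectors d) (random_vector d W)
                              (up_event M d W W' k) \<omega>\<bar> \<partial>M)
         + (\<integral>\<omega>. \<bar>real (W k \<omega>) - c k * cond_prob_given M (nat_vectors d) (random_vector d W)
                              (down_event M d W W' k) \<omega>\<bar> \<partial>M)))"
    (is "_ \<le> (\<Sum>k=1..d. ?bound k)")
proof -
  interpret M: prob_space M by fact
  interpret N: prob_space N by fact
  define H where "H k = resample_upto lam k h" for k
  define EW where "EW k = (\<integral>\<omega>. H k (random_vector d W \<omega>) \<partial>M)" for k
  define EZ where "EZ k = (\<integral>\<omega>. H k (random_vector d Z \<omega>) \<partial>N)" for k
  have H: "H k x \<in> {0..1}" if "k \<le> d" "x \<in> {1..d} \<rightarrow>\<^sub>E UNIV" for k x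
    unfolding H_def using assms(10) that by (rule resample_upto_in_unit_interval)
  \<comment> \<open>\<open>H k\<close> depends only on coordinates k + 1, ..., d, so the
    one-coordinate bound applies to the replacement of coordinate k + 1.\<close>
  have step: "\<bar>EW k - EW (Suc k)\<bar> \<le> ?bound (Suc k)" if "k < d" for k
  proof -
    have "depends_on d {Suc k..d} (H k)"
      unfolding H_def using depends_on_resample_upto[of k d] that by simp
    then show ?thesis
      unfolding EW_def H_def resample_upto.simps unfolding H_def[symmetric]
      using that H by (intro resample_error_le assms) auto
  qed
  have "\<bar>EW 0 - EW k\<bar> \<le> (\<Sum>i=1..k. ?bound i)" if "k \<le> d" for k
    using that
  proof (induction k)
    case (Suc k)
    have "\<bar>EW 0 - EW (Suc k)\<bar> \<le> \<bar>EW 0 - EW k\<bar> + \<bar>EW k - EW (Suc k)\<bar>" by linarith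
    also have "\<dots> \<le> (\<Sum>i=1..k. ?bound i) + ?bound (Suc k)"
      using Suc step[of k] by (intro add_mono) auto
    finally show ?case by simp
  qed simp
  then have "\<bar>EW 0 - EW d\<bar> \<le> (\<Sum>k=1..d. ?bound k)" by simp
  \<comment> \<open>Under Z the replacements cost nothing, since each redraws a coordinate
    independently from its own law.\<close>
  moreover have "EZ k = EZ 0" if "k \<le> d" for k
    using that
  proof (induction k)
    case (Suc k)
    have "EZ (Suc k) = EZ k"
      unfolding EZ_def H_def resample_upto.simps unfolding H_def[symmetric]
      using Suc.prems H
      by (intro integral_random_vector_resample[where p = "\<lambda>i. Poi (lam i)"] assms) auto
    with Suc show ?case by simp
  qed simp
  \<comment> \<open>After d replacements no coordinate is left, so \<open>H d\<close> is constant on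
    the space and has the same mean under both laws. The sample point defining x is
    arbitrary.\<close>
  moreover have "EW d = EZ d"
  proof -
    have "depends_on d {} (H d)"
      using depends_on_resample_upto[of d d lam h] by (simp add: H_def)
    then have const: "H d x = H d y" if "x \<in> {1..d} \<rightarrow>\<^sub>E UNIV" "y \<in> {1..d} \<rightarrow>\<^sub>E UNIV" for x y
      unfolding depends_on_def by (metis empty_iff that)
    define x where "x = random_vector d W undefined"
    have "H d (random_vector d W \<omega>) = H d x" "H d (random_vector d Z \<omega>') = H d x" for \<omega> \<omega>'
      unfolding x_def by (intro const random_vector_in_space)+
    then show ?thesis by (simp add: EW_def EZ_def M.prob_space N.prob_space)
  qed
  ultimately show ?thesis by (simp add: EW_def EZ_def H_def)
qed

end
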